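(* For every orientation-preserving harmonic mapping $f$ in $\mathbb D$ with $\|\omega_f\|_\infty<1$, $$\frac{d_{\mathrm{aff}}(f)}2\le r_{\mathrm{aff}}(f)\le J\bigl(d_{\mathrm{aff}}(f)\bigr),\qquad J(t)=\operatorname{arcsinh}\!\left(\frac{2}{\sqrt3}\sinh\frac t2\right).$$ Both inequalities are sharp within the class of globally univalent harmonic quasiconformal mappings.
   Context: $\mathbb D$ is the open unit disk in $\mathbb C$. An orientation-preserving harmonic mapping in $\mathbb D$ is a complex-valued harmonic function $f=h+\overline g$, with $h,g$ analytic in $\mathbb D$, whose Jacobian $|h'|^2-|g'|^2$ is positive everywhere; its complex dilatation $\omega_f=g'/h'$ is an analytic map $\mathbb D\to\mathbb D$. It need not be injective; (globally) univalent means injective in $\mathbb D$. $\|\cdot\|_\infty$ is the supremum norm on $\mathbb D$. A globally univalent harmonic quasiconformal mapping is a univalent orientation-preserving harmonic mapping $f$ in $\mathbb D$ with $\|\omega_f\|_\infty<1$ (such an $f$ is a quasiconformal homeomorphism onto its image). Hyperbolic distance: $d_{\mathbb D}(z_1,z_2)=2\operatorname{arctanh}\left|\frac{z_1-z_2}{1-\overline{z_2}z_1}\right|$. For a nonempty hyperbolically bounded $E\subset\mathbb D$: $\operatorname{rad}_{\mathbb D}(E)=\inf_{c\in\mathbb D}\sup_{\zeta\in E}d_{\mathbb D}(c,\zeta)$ and $\operatorname{diam}_{\mathbb D}(E)=\sup_{\zeta,\eta\in E}d_{\mathbb D}(\zeta,\eta)$. Put $r_{\mathrm{aff}}(f)=\operatorname{rad}_{\mathbb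 D}(\overline{\omega_f(\mathbb D)})$ and $d_{\mathrm{aff}}(f)=\operatorname{diam}_{\mathbb D}(\overline{\omega_f(\mathbb D)})$, where the bar over a set denotes closure. *)

theory Defs
  imports "HOL-Complex_Analysis.Complex_Analysis"
begin

abbreviation unit_disc :: "complex set" (\<open>\<D>\<close>) where
  "\<D> \<equiv> ball 0 1"

text \<open>The canonical decomposition is unique only up to additive constants, so it is kept as a
  relation between \<open>f\<close> and the pair \<open>(h, g)\<close>.\<close>

definition harmonic_decomp :: "(complex \<Rightarrow> complex) \<Rightarrow> (complex \<Rightarrow> complex) \<Rightarrow> (complex \<Rightarrow> complex) \<Rightarrow> bool" where
  "harmonic_decomp f h g \<longleftrightarrow>
     h holomorphic_on \<D> \<and> g holomorphic_on \<D> \<and> (\<forall>z\<in>\<D>. f z = h z + cnj (g z))"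

definition op_harmonic_mapping :: "(complex \<Rightarrow> complex) \<Rightarrow> bool" where
  "op_harmonic_mapping f \<longleftrightarrow>
     (\<exists>h g. harmonic_decomp f h g \<and> (\<forall>z\<in>\<D>. (cmod (deriv h z))\<^sup>2 - (cmod (deriv g z))\<^sup>2 > 0))"

text \<open>The quotient does not depend on the chosen decomposition, see \<open>dilatation_eq\<close> below.\<close>

definition dilatation :: "(complex \<Rightarrow> complex) \<Rightarrow> complex \<Rightarrow> complex" where
  "dilatation f z = (THE w. \<exists>h g. harmonic_decomp f h g \<and> w = deriv g z / deriv h z)"

definition sup_norm_disc :: "(complex \<Rightarrow> complex) \<Rightarrow> real" where
  "sup_norm_disc \<omega> = (SUP z\<in>\<D>. cmod (\<omega> z))"

definition univalent_harmonic_qc :: "(complex \<Rightarrow> complex) \<Rightarrow> bool" where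
  "univalent_harmonic_qc f \<longleftrightarrow>
     op_harmonic_mapping f \<and> inj_on f \<D> \<and> sup_norm_disc (dilatation f) < 1"

definition hyp_dist :: "complex \<Rightarrow> complex \<Rightarrow> real" where
  "hyp_dist z\<^sub>1 z\<^sub>2 = 2 * artanh (cmod ((z\<^sub>1 - z\<^sub>2) / (1 - cnj z\<^sub>2 * z\<^sub>1)))"

text \<open>Real-valued suprema and infima: both definitions are meaningful for nonempty,
  hyperbolically bounded \<open>E \<subseteq> \<D>\<close> only.\<close>

definition hyp_rad :: "complex set \<Rightarrow> real" where
  "hyp_rad E = (INF c\<in>\<D>. SUP \<zeta>\<in>E. hyp_dist c \<zeta>)"

definition hyp_diam :: "complex set \<Rightarrow> real" where
  "hyp_diam E = (SUP (\<zeta>, \<eta>)\<in>E \<times> E. hyp_dist \<zeta> \<eta>)"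

definition r_aff :: "(complex \<Rightarrow> complex) \<Rightarrow> real" where
  "r_aff f = hyp_rad (closure (dilatation f ` \<D>))"

definition d_aff :: "(complex \<Rightarrow> complex) \<Rightarrow> real" where
  "d_aff f = hyp_diam (closure (dilatation f ` \<D>))"

definition jung_fun :: "real \<Rightarrow> real" where
  "jung_fun t = arsinh (2 / sqrt 3 * sinh (t / 2))"

lemma harmonic_decomp_deriv_unique:
  assumes 1: "harmonic_decomp f h\<^sub>1 g\<^sub>1" and 2: "harmonic_decomp f h\<^sub>2 g\<^sub>2" and z: "z \<in> \<D>"
  shows "deriv h\<^sub>1 z = deriv h\<^sub>2 z" "deriv g\<^sub>1 z = deriv g\<^sub>2 z"
proof -
  have D: "(f has_derivative (\<lambda>v. deriv h z * v + cnj (deriv g z * v))) (at z)"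
    if d: "harmonic_decomp f h g" for h g
  proof -
    have "(h has_field_derivative deriv h z) (at z)" "(g has_field_derivative deriv g z) (at z)"
      using d z by (auto simp: harmonic_decomp_def intro: holomorphic_derivI)
    then have "((\<lambda>z. h z + cnj (g z)) has_derivative (\<lambda>v. deriv h z * v + cnj (deriv g z * v))) (at z)"
      unfolding has_field_derivative_def
      by (intro has_derivative_add bounded_linear.has_derivative[OF bounded_linear_cnj])
    then show ?thesis
      by (rule has_derivative_transform_within_open[of _ _ _ _ \<D>])
        (use d z in \<open>auto simp: harmonic_decomp_def\<close>)
  qed
  have eq: "deriv h\<^sub>1 z * v + cnj (deriv g\<^sub>1 z * v) = deriv h\<^sub>2 z * v + cnj (deriv g\<^sub>2 z * v)" for v
    using has_derivative_unique[OF D[OF 1] D[OF 2]] by meson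
  show "deriv h\<^sub>1 z = deriv h\<^sub>2 z" "deriv g\<^sub>1 z = deriv g\<^sub>2 z"
    using eq[of 1] eq[of \<i>] by (auto simp: complex_eq_iff)
qed

lemma dilatation_eq:
  assumes "harmonic_decomp f h g" "z \<in> \<D>"
  shows "dilatation f z = deriv g z / deriv h z"
  unfolding dilatation_def
proof (rule the_equality)
  show "\<exists>h' g'. harmonic_decomp f h' g' \<and> deriv g z / deriv h z = deriv g' z / deriv h' z"
    using assms by blast
next
  fix w assume "\<exists>h' g'. harmonic_decomp f h' g' \<and> w = deriv g' z / deriv h' z"
  then show "w = deriv g z / deriv h z"
    using harmonic_decomp_deriv_unique[OF assms(1) _ assms(2)] by auto
qed

end

theory Submission imports Defs begin

text \<open>All distances are handled through
  \<open>sinh (d(z, w) / 2) = |z - w| / sqrt ((1 - |z|\<^sup>2) (1 - |w|\<^sup>2))\<close>.  A compact set \<open>E\<close> in the disc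
  has a hyperbolic circumcentre, which a Moebius map moves to \<open>0\<close>.  If \<open>0\<close> were outside the convex
  hull of the farthest points of \<open>E\<close>, a small displacement of the centre would reduce the radius.
  So \<open>0\<close> is a convex combination of at most three farthest points, and two of them are seen from \<open>0\<close>
  under an angle of at least \<open>2 \<pi> / 3\<close>; this is the upper bound.  Every bounded holomorphic \<open>\<omega>\<close> with
  \<open>|\<omega>| \<le> k < 1\<close> is the dilatation of a univalent mapping, so it suffices to choose its image: a
  disc about \<open>0\<close> for the lower bound, and for the upper bound (by the Riemann mapping theorem) the
  interior of an equilateral Euclidean triangle centred at \<open>0\<close>.  Its hyperbolic diameter is attained
  at the vertices because hyperbolic balls are Euclidean convex.\<close>

section \<open>The hyperbolic distance in \<open>sinh\<close> form\<close>

lemma one_minus_norm_sq_pos: "z \<in> \<D> \<Longrightarrow> 0 < 1 - (cmod z)\<^sup>2"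
  by (simp add: power_less_one_iff abs_square_less_1)

text \<open>The algebraic fact behind the \<open>sinh\<close> formula, the nonvanishing of Moebius
  denominators and the change of \<open>1 - |z|^2\<close> under Moebius maps.\<close>

lemma norm_denominator_identity:
  "(cmod (1 - cnj w * z))\<^sup>2 = (cmod (z - w))\<^sup>2 + (1 - (cmod z)\<^sup>2) * (1 - (cmod w)\<^sup>2)"
  unfolding cmod_power2 by (simp add: power2_eq_square algebra_simps)

lemma moebius_denominator_nonzero:
  assumes "z \<in> \<D>" "w \<in> \<D>"
  shows "1 - cnj w * z \<noteq> 0"
proof -
  have "0 < (cmod (1 - cnj w * z))\<^sup>2"
    unfolding norm_denominator_identity
    using one_minus_norm_sq_pos assms by (simp add: add_nonneg_pos)
  then show ?thesis by auto
qed

lemma sinh_artanh: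
  fixes x :: real
  assumes "\<bar>x\<bar> < 1"
  shows "sinh (artanh x) = x / sqrt (1 - x\<^sup>2)"
proof -
  define y where "y = (1 + x) / (1 - x)"
  have y: "0 < y" using assms by (auto simp: y_def)
  have "exp (artanh x) = sqrt y"
    using y by (simp add: artanh_def y_def [symmetric] ln_sqrt [symmetric])
  then have "sinh (artanh x) = (sqrt y - inverse (sqrt y)) / 2"
    by (simp add: sinh_field_def exp_minus)
  also have "\<dots> = (y - 1) / (2 * sqrt y)"
    using y by (simp add: field_simps)
  also have "sqrt y = sqrt (1 - x\<^sup>2) / (1 - x)"
  proof -
    have "1 - x\<^sup>2 = (1 + x) * (1 - x)" by (simp add: power2_eq_square algebra_simps)
    then have "y = (1 - x\<^sup>2) / (1 - x)\<^sup>2"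
      using assms by (simp add: y_def power2_eq_square)
    then show ?thesis using assms by (simp add: real_sqrt_divide)
  qed
  also have "y - 1 = 2 * x / (1 - x)"
    using assms by (simp add: y_def field_simps)
  also have "2 * x / (1 - x) / (2 * (sqrt (1 - x\<^sup>2) / (1 - x))) = x / sqrt (1 - x\<^sup>2)"
    using assms by simp
  finally show ?thesis .
qed

lemma sinh_half_hyp_dist:
  assumes "z \<in> \<D>" "w \<in> \<D>"
  shows "sinh (hyp_dist z w / 2) = cmod (z - w) / (sqrt (1 - (cmod z)\<^sup>2) * sqrt (1 - (cmod w)\<^sup>2))"
proof -
  define m where "m = cmod (1 - cnj w * z)"
  define q where "q = (1 - (cmod z)\<^sup>2) * (1 - (cmod w)\<^sup>2)"
  define p where "p = cmod (z - w) / m"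
  have m: "0 < m" using moebius_denominator_nonzero [OF assms] by (simp add: m_def)
  have q: "0 < q" using one_minus_norm_sq_pos assms by (simp add: q_def)
  have mq: "m\<^sup>2 = (cmod (z - w))\<^sup>2 + q" unfolding m_def q_def by (rule norm_denominator_identity)
  have p: "1 - p\<^sup>2 = q / m\<^sup>2"
  proof -
    have "1 - p\<^sup>2 = (m\<^sup>2 - (cmod (z - w))\<^sup>2) / m\<^sup>2"
      using m by (simp add: p_def power_divide diff_divide_distrib)
    then show ?thesis by (simp add: mq)
  qed
  have "p\<^sup>2 < 1" using p q m by (smt (verit) divide_pos_pos zero_less_power)
  then have "\<bar>p\<bar> < 1" by (simp add: abs_square_less_1)
  then have "sinh (hyp_dist z w / 2) = p / sqrt (1 - p\<^sup>2)"
    by (simp add: hyp_dist_def norm_divide p_def m_def sinh_artanh)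
  also have "\<dots> = cmod (z - w) / sqrt q"
    using m unfolding p by (simp add: real_sqrt_divide p_def)
  finally show ?thesis by (simp add: q_def real_sqrt_mult)
qed

lemma hyp_dist_eq_arsinh:
  assumes "z \<in> \<D>" "w \<in> \<D>"
  shows "hyp_dist z w = 2 * arsinh (cmod (z - w) / (sqrt (1 - (cmod z)\<^sup>2) * sqrt (1 - (cmod w)\<^sup>2)))"
  using arsinh_sinh_real [of "hyp_dist z w / 2"] sinh_half_hyp_dist [OF assms] by simp

lemma hyp_dist_nonneg: "z \<in> \<D> \<Longrightarrow> w \<in> \<D> \<Longrightarrow> 0 \<le> hyp_dist z w"
  using sinh_real_nonneg_iff [of "hyp_dist z w / 2"] sinh_half_hyp_dist [of z w]
    one_minus_norm_sq_pos [of z] one_minus_norm_sq_pos [of w] by simp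

lemma hyp_dist_commute: "z \<in> \<D> \<Longrightarrow> w \<in> \<D> \<Longrightarrow> hyp_dist z w = hyp_dist w z"
  by (simp add: hyp_dist_eq_arsinh norm_minus_commute mult.commute)

lemma continuous_on_hyp_dist:
  assumes "continuous_on S f" "continuous_on S g" "f ` S \<subseteq> \<D>" "g ` S \<subseteq> \<D>"
  shows "continuous_on S (\<lambda>x. hyp_dist (f x) (g x))"
proof -
  have "continuous_on S (\<lambda>x. 2 * arsinh (cmod (f x - g x) /
      (sqrt (1 - (cmod (f x))\<^sup>2) * sqrt (1 - (cmod (g x))\<^sup>2))))"
    using assms(3,4) one_minus_norm_sq_pos
    by (intro continuous_intros continuous_on_compose2 [OF continuous_on_arsinh] assms(1,2))
      (force simp: image_subset_iff)+
  then show ?thesis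
    using assms(3,4) by (subst continuous_on_cong [OF refl hyp_dist_eq_arsinh]) auto
qed

section \<open>Moebius invariance\<close>

lemma one_minus_norm_Moebius:
  assumes "z \<in> \<D>" "c \<in> \<D>"
  shows "1 - (cmod (Moebius_function 0 c z))\<^sup>2
    = (1 - (cmod z)\<^sup>2) * (1 - (cmod c)\<^sup>2) / (cmod (1 - cnj c * z))\<^sup>2"
  using moebius_denominator_nonzero [OF assms] norm_denominator_identity [of c z]
  by (simp add: Moebius_function_simple norm_divide power_divide field_simps)

lemma Moebius_in_disc: "z \<in> \<D> \<Longrightarrow> c \<in> \<D> \<Longrightarrow> Moebius_function 0 c z \<in> \<D>"
  using Moebius_function_norm_lt_1 by simp

text \<open>Numerator and denominator of the \<open>arsinh\<close> form are both multiplied by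
  \<open>(1 - |c|^2) / (|1 - cnj c * z| |1 - cnj c * w|)\<close>.\<close>

lemma hyp_dist_Moebius:
  assumes "z \<in> \<D>" "w \<in> \<D>" "c \<in> \<D>"
  shows "hyp_dist (Moebius_function 0 c z) (Moebius_function 0 c w) = hyp_dist z w"
proof -
  let ?M = "Moebius_function 0 c"
  note nz = moebius_denominator_nonzero [OF assms(1,3)] moebius_denominator_nonzero [OF assms(2,3)]
  have c: "0 < 1 - (cmod c)\<^sup>2" using assms one_minus_norm_sq_pos by blast
  have "?M z - ?M w = (z - w) * (1 - cnj c * c) / ((1 - cnj c * z) * (1 - cnj c * w))"
    using nz by (simp add: Moebius_function_simple divide_simps) (simp add: algebra_simps)
  moreover have "1 - cnj c * c = of_real (1 - (cmod c)\<^sup>2)"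
    by (simp only: of_real_diff of_real_1 complex_norm_square mult.commute)
  ultimately have "cmod (?M z - ?M w)
      = cmod (z - w) * (1 - (cmod c)\<^sup>2) / (cmod (1 - cnj c * z) * cmod (1 - cnj c * w))"
    using c by (metis abs_of_pos norm_divide norm_mult norm_of_real)
  moreover have "sqrt (1 - (cmod (?M z))\<^sup>2) * sqrt (1 - (cmod (?M w))\<^sup>2)
      = sqrt (1 - (cmod z)\<^sup>2) * sqrt (1 - (cmod w)\<^sup>2) * (1 - (cmod c)\<^sup>2)
        / (cmod (1 - cnj c * z) * cmod (1 - cnj c * w))"
    unfolding one_minus_norm_Moebius [OF assms(1,3)] one_minus_norm_Moebius [OF assms(2,3)]
    using c by (simp add: real_sqrt_mult real_sqrt_divide)
  ultimately show ?thesis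
    unfolding hyp_dist_eq_arsinh [OF assms(1,2)]
      hyp_dist_eq_arsinh [OF Moebius_in_disc [OF assms(1,3)] Moebius_in_disc [OF assms(2,3)]]
    using c nz by simp
qed

lemma hyp_dist_Moebius_center:
  assumes "c \<in> \<D>" "z \<in> \<D>"
  shows "hyp_dist 0 (Moebius_function 0 c z) = hyp_dist c z"
  using hyp_dist_Moebius [of c z c] assms by (simp add: Moebius_function_eq_zero)

section \<open>Distances from the origin, triangle inequality, convexity of balls\<close>

lemma sinh_half_hyp_dist_0:
  "z \<in> \<D> \<Longrightarrow> sinh (hyp_dist 0 z / 2) = cmod z / sqrt (1 - (cmod z)\<^sup>2)"
  by (simp add: sinh_half_hyp_dist)

lemma cosh_half_hyp_dist_0:
  assumes "z \<in> \<D>"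
  shows "cosh (hyp_dist 0 z / 2) = 1 / sqrt (1 - (cmod z)\<^sup>2)"
proof -
  have "(cosh (hyp_dist 0 z / 2))\<^sup>2 = (1 / sqrt (1 - (cmod z)\<^sup>2))\<^sup>2"
    using one_minus_norm_sq_pos [OF assms]
    by (simp add: cosh_square_eq sinh_half_hyp_dist_0 [OF assms] power_divide field_simps)
  then show ?thesis
    using one_minus_norm_sq_pos [OF assms] by (subst (asm) power2_eq_iff_nonneg) auto
qed

lemma sinh_hyp_dist_0:
  assumes "z \<in> \<D>"
  shows "sinh (hyp_dist 0 z) = 2 * cmod z / (1 - (cmod z)\<^sup>2)"
proof -
  have "sinh (hyp_dist 0 z) = 2 * sinh (hyp_dist 0 z / 2) * cosh (hyp_dist 0 z / 2)"
    using sinh_double [of "hyp_dist 0 z / 2"] by simp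
  also have "\<dots> = 2 * cmod z / (sqrt (1 - (cmod z)\<^sup>2) * sqrt (1 - (cmod z)\<^sup>2))"
    unfolding sinh_half_hyp_dist_0 [OF assms] cosh_half_hyp_dist_0 [OF assms] by simp
  finally show ?thesis
    using one_minus_norm_sq_pos [OF assms] by simp
qed

lemma hyp_dist_0_le_iff:
  assumes "z \<in> \<D>" "w \<in> \<D>"
  shows "hyp_dist 0 z \<le> hyp_dist 0 w \<longleftrightarrow> cmod z \<le> cmod w"
proof -
  have "hyp_dist 0 z \<le> hyp_dist 0 w \<longleftrightarrow> cosh (hyp_dist 0 z / 2) \<le> cosh (hyp_dist 0 w / 2)"
    using hyp_dist_nonneg assms by (subst cosh_real_nonneg_le_iff) auto
  also have "\<dots> \<longleftrightarrow> (cmod z)\<^sup>2 \<le> (cmod w)\<^sup>2"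
    using one_minus_norm_sq_pos [of z] one_minus_norm_sq_pos [of w] assms
    by (simp add: cosh_half_hyp_dist_0 field_simps)
  finally show ?thesis by (simp add: abs_le_square_iff [symmetric])
qed

text \<open>After the Euclidean triangle inequality in the numerator, the \<open>sinh\<close>
  formula becomes the addition formula for \<open>sinh\<close>.\<close>

lemma hyp_dist_triangle_0:
  assumes "z \<in> \<D>" "w \<in> \<D>"
  shows "hyp_dist z w \<le> hyp_dist 0 z + hyp_dist 0 w"
proof -
  have "sinh (hyp_dist z w / 2)
      \<le> (cmod z + cmod w) / (sqrt (1 - (cmod z)\<^sup>2) * sqrt (1 - (cmod w)\<^sup>2))"
    using one_minus_norm_sq_pos assms
    by (auto simp: sinh_half_hyp_dist norm_triangle_ineq4 less_imp_le intro!: divide_right_mono)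
  also have "\<dots> = sinh (hyp_dist 0 z / 2 + hyp_dist 0 w / 2)"
    using one_minus_norm_sq_pos [of z] one_minus_norm_sq_pos [of w] assms
    by (simp only: sinh_add sinh_half_hyp_dist_0 cosh_half_hyp_dist_0) (simp add: add_divide_distrib)
  finally show ?thesis by simp
qed

lemma hyp_dist_triangle:
  assumes "z \<in> \<D>" "w \<in> \<D>" "c \<in> \<D>"
  shows "hyp_dist z w \<le> hyp_dist c z + hyp_dist c w"
  using hyp_dist_triangle_0 [OF Moebius_in_disc [OF assms(1,3)] Moebius_in_disc [OF assms(2,3)]]
  unfolding hyp_dist_Moebius [OF assms] hyp_dist_Moebius_center [OF assms(3,1)]
    hyp_dist_Moebius_center [OF assms(3,2)] .

text \<open>A hyperbolic ball is a sublevel set of the convex function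
  \<open>\<lambda>\<zeta>. (cmod (\<zeta> - c))\<^sup>2 + C * (cmod \<zeta>)\<^sup>2\<close>, which is centred at \<open>c / (1 + C)\<close>.\<close>

lemma convex_hyp_ball:
  assumes c: "c \<in> \<D>" and R: "0 \<le> R"
  shows "convex {z \<in> \<D>. hyp_dist c z \<le> R}"
proof -
  \<comment> \<open>\<open>C\<close> makes the squared ball inequality read
    \<open>|c - z|^2 <= C * (1 - |z|^2)\<close>; completing the square gives centre
    \<open>c / (1 + C)\<close> and squared radius \<open>M\<close>.\<close>
  define C where "C = (sinh (R / 2))\<^sup>2 * (1 - (cmod c)\<^sup>2)"
  define M where "M = (C - (cmod c)\<^sup>2 + (cmod c)\<^sup>2 / (1 + C)) / (1 + C)"
  have C: "0 \<le> C" using one_minus_norm_sq_pos [OF c] by (simp add: C_def)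
  have "hyp_dist c z \<le> R \<longleftrightarrow> z \<in> cball (c /\<^sub>R (1 + C)) (sqrt M)" if z: "z \<in> \<D>" for z
  proof -
    have pos: "0 < sqrt (1 - (cmod c)\<^sup>2) * sqrt (1 - (cmod z)\<^sup>2)"
      using one_minus_norm_sq_pos c z by simp
    have "hyp_dist c z \<le> R \<longleftrightarrow> sinh (hyp_dist c z / 2) \<le> sinh (R / 2)" by simp
    also have "\<dots> \<longleftrightarrow> cmod (c - z) \<le> sinh (R / 2) * (sqrt (1 - (cmod c)\<^sup>2) * sqrt (1 - (cmod z)\<^sup>2))"
      unfolding sinh_half_hyp_dist [OF c z] pos_divide_le_eq [OF pos] ..
    also have "\<dots> \<longleftrightarrow> (cmod (c - z))\<^sup>2 \<le> (sinh (R / 2) * (sqrt (1 - (cmod c)\<^sup>2) * sqrt (1 - (cmod z)\<^sup>2)))\<^sup>2"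
      using pos R by (intro power_mono_iff [symmetric]) auto
    also have "\<dots> \<longleftrightarrow> (cmod (c - z))\<^sup>2 \<le> C * (1 - (cmod z)\<^sup>2)"
      using one_minus_norm_sq_pos [OF c] one_minus_norm_sq_pos [OF z]
      by (simp add: C_def power_mult_distrib mult.assoc)
    also have "\<dots> \<longleftrightarrow> (cmod (c /\<^sub>R (1 + C) - z))\<^sup>2 \<le> M"
    proof -
      have "(cmod (c /\<^sub>R (1 + C) - z))\<^sup>2 - M = ((cmod (c - z))\<^sup>2 - C * (1 - (cmod z)\<^sup>2)) / (1 + C)"
        using C unfolding M_def cmod_power2
        by (simp add: divide_simps) (simp add: power2_eq_square algebra_simps)
      then show ?thesis using C by (smt (verit) divide_le_0_iff)
    qed
    also have "\<dots> \<longleftrightarrow> z \<in> cball (c /\<^sub>R (1 + C)) (sqrt M)"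
      using real_sqrt_le_iff [of "(cmod (c /\<^sub>R (1 + C) - z))\<^sup>2" M] by (simp add: dist_norm)
    finally show ?thesis .
  qed
  then have "{z \<in> \<D>. hyp_dist c z \<le> R} = \<D> \<inter> cball (c /\<^sub>R (1 + C)) (sqrt M)" by auto
  then show ?thesis by (simp add: convex_Int)
qed


text \<open>After squaring, \<open>|z|^2\<close> cancels. For \<open>c\<close> near \<open>0\<close>
  the right-hand side is of second order, so the sign of \<open>c \<bullet> z\<close> tells whether
  moving the centre from \<open>0\<close> to \<open>c\<close> approaches \<open>z\<close>.\<close>

lemma hyp_dist_0_le_iff_inner:
  assumes c: "c \<in> \<D>" and z: "z \<in> \<D>"
  shows "hyp_dist 0 z \<le> hyp_dist c z \<longleftrightarrow> 2 * (c \<bullet> z) \<le> (cmod c)\<^sup>2 * (1 + (cmod z)\<^sup>2)"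
proof -
  have pos: "0 < sqrt (1 - (cmod c)\<^sup>2)" "0 < sqrt (1 - (cmod z)\<^sup>2)"
    using one_minus_norm_sq_pos c z by simp_all
  have "hyp_dist 0 z \<le> hyp_dist c z \<longleftrightarrow> sinh (hyp_dist 0 z / 2) \<le> sinh (hyp_dist c z / 2)" by simp
  also have "\<dots> \<longleftrightarrow> cmod z * sqrt (1 - (cmod c)\<^sup>2) \<le> cmod (c - z)"
    using pos by (simp only: sinh_half_hyp_dist_0 [OF z] sinh_half_hyp_dist [OF c z]) (simp add: field_simps)
  also have "\<dots> \<longleftrightarrow> (cmod z * sqrt (1 - (cmod c)\<^sup>2))\<^sup>2 \<le> (cmod (c - z))\<^sup>2"
    using pos by (intro power_mono_iff [symmetric]) auto
  also have "\<dots> \<longleftrightarrow> 2 * (c \<bullet> z) \<le> (cmod c)\<^sup>2 * (1 + (cmod z)\<^sup>2)"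
    using pos by (simp add: power_mult_distrib power2_norm_eq_inner inner_diff algebra_simps inner_commute)
  finally show ?thesis .
qed

lemma hyp_dist_0_tanh:
  assumes "0 \<le> R"
  shows "hyp_dist 0 (of_real (tanh (R / 2))) = R"
  using assms by (simp add: hyp_dist_def artanh_tanh_real)

lemma tendsto_hyp_dist:
  assumes "(f \<longlongrightarrow> a) F" "(g \<longlongrightarrow> b) F" "a \<in> \<D>" "b \<in> \<D>"
  shows "((\<lambda>x. hyp_dist (f x) (g x)) \<longlongrightarrow> hyp_dist a b) F"
proof -
  have "continuous_on (\<D> \<times> \<D>) (\<lambda>p. hyp_dist (fst p) (snd p))"
    by (intro continuous_on_hyp_dist continuous_intros) auto
  then have "isCont (\<lambda>p. hyp_dist (fst p) (snd p)) (a, b)"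
    using assms by (simp add: continuous_on_eq_continuous_at open_Times)
  from isCont_tendsto_compose [OF this tendsto_Pair [OF assms(1,2)]] show ?thesis by simp
qed

section \<open>Circumradius and circumcentre of compact sets\<close>

lemma bdd_above_hyp_dist:
  assumes "compact E" "E \<subseteq> \<D>" "c \<in> \<D>"
  shows "bdd_above (hyp_dist c ` E)"
  by (intro bounded_imp_bdd_above compact_imp_bounded compact_continuous_image
      continuous_on_hyp_dist continuous_intros) (use assms in auto)

lemma hyp_rad_le:
  assumes E: "compact E" "E \<subseteq> \<D>" "E \<noteq> {}" and c: "c \<in> \<D>" "\<And>\<zeta>. \<zeta> \<in> E \<Longrightarrow> hyp_dist c \<zeta> \<le> R"
  shows "hyp_rad E \<le> R"
proof -
  obtain \<zeta>\<^sub>0 where "\<zeta>\<^sub>0 \<in> E" using E by blast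
  \<comment> \<open>Nonnegative distances bound the suprema below, so that the real-valued infimum
    is a genuine lower bound.\<close>
  then have "0 \<le> (SUP \<zeta>\<in>E. hyp_dist x \<zeta>)" if "x \<in> \<D>" for x
    using E that by (intro cSUP_upper2 [where x = \<zeta>\<^sub>0] bdd_above_hyp_dist hyp_dist_nonneg) auto
  then have "bdd_below ((\<lambda>c. SUP \<zeta>\<in>E. hyp_dist c \<zeta>) ` \<D>)"
    by (intro bdd_belowI2)
  then have "hyp_rad E \<le> (SUP \<zeta>\<in>E. hyp_dist c \<zeta>)"
    unfolding hyp_rad_def using c by (intro cINF_lower)
  also have "\<dots> \<le> R" using E c by (intro cSUP_least)
  finally show ?thesis .
qed

lemma hyp_rad_ge:
  assumes E: "compact E" "E \<subseteq> \<D>" and R: "\<And>c. c \<in> \<D> \<Longrightarrow> \<exists>\<zeta>\<in>E. R \<le> hyp_dist c \<zeta>"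
  shows "R \<le> hyp_rad E"
  unfolding hyp_rad_def
proof (rule cINF_greatest)
  fix c assume c: "c \<in> \<D>"
  then obtain \<zeta> where "\<zeta> \<in> E" "R \<le> hyp_dist c \<zeta>" using R by blast
  then show "R \<le> (SUP \<zeta>\<in>E. hyp_dist c \<zeta>)"
    using E c by (intro cSUP_upper2 [where x = \<zeta>] bdd_above_hyp_dist)
qed simp

lemma hyp_rad_le_farthest:
  assumes E: "compact E" "E \<subseteq> \<D>" "E \<noteq> {}" and c: "c \<in> \<D>"
  shows "\<exists>\<zeta>\<in>E. hyp_rad E \<le> hyp_dist c \<zeta>"
proof -
  have "continuous_on E (hyp_dist c)"
    by (intro continuous_on_hyp_dist continuous_intros) (use E c in auto)
  then obtain \<zeta> where "\<zeta> \<in> E" "\<And>\<eta>. \<eta> \<in> E \<Longrightarrow> hyp_dist c \<eta> \<le> hyp_dist c \<zeta>"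
    using continuous_attains_sup E by metis
  then show ?thesis using hyp_rad_le [OF E c] by blast
qed

text \<open>A minimising sequence of centres stays in one hyperbolic ball about \<open>0\<close>,
  hence in a compact Euclidean ball inside the disc; by continuity a subsequential limit is a
  centre.\<close>

lemma hyp_center_exists:
  assumes E: "compact E" "E \<subseteq> \<D>" "E \<noteq> {}"
  obtains c where "c \<in> \<D>" "\<And>\<zeta>. \<zeta> \<in> E \<Longrightarrow> hyp_dist c \<zeta> \<le> hyp_rad E"
proof -
  define R where "R = hyp_rad E"
  have "\<exists>c\<in>\<D>. \<forall>\<zeta>\<in>E. hyp_dist c \<zeta> \<le> R + inverse (real (Suc n))" for n
  proof -
    have "(INF c\<in>\<D>. SUP \<zeta>\<in>E. hyp_dist c \<zeta>) < R + inverse (real (Suc n))"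
      by (simp add: R_def hyp_rad_def)
    then obtain c where c: "c \<in> \<D>" "(SUP \<zeta>\<in>E. hyp_dist c \<zeta>) < R + inverse (real (Suc n))"
      using cInf_lessD [of "(\<lambda>c. SUP \<zeta>\<in>E. hyp_dist c \<zeta>) ` \<D>"] by force
    have "hyp_dist c \<zeta> \<le> R + inverse (real (Suc n))" if "\<zeta> \<in> E" for \<zeta>
      using cSUP_upper [OF that bdd_above_hyp_dist [OF E(1,2) c(1)]] c(2) by linarith
    then show ?thesis using c by blast
  qed
  then obtain c where c: "\<And>n. c n \<in> \<D>"
    "\<And>n \<zeta>. \<zeta> \<in> E \<Longrightarrow> hyp_dist (c n) \<zeta> \<le> R + inverse (real (Suc n))" by metis
  obtain \<zeta>\<^sub>0 where \<zeta>\<^sub>0: "\<zeta>\<^sub>0 \<in> E" "\<zeta>\<^sub>0 \<in> \<D>" using E by blast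
  \<comment> \<open>Triangle inequality through \<open>\<zeta>\<^sub>0\<close>; the summand 1 bounds
    \<open>inverse (real (Suc n))\<close>.\<close>
  define B where "B = hyp_dist 0 \<zeta>\<^sub>0 + R + 1"
  define k where "k = tanh (B / 2)"
  have B: "hyp_dist 0 (c n) \<le> B" for n
  proof -
    have "hyp_dist 0 (c n) \<le> hyp_dist \<zeta>\<^sub>0 0 + hyp_dist \<zeta>\<^sub>0 (c n)"
      using \<zeta>\<^sub>0 c by (intro hyp_dist_triangle) auto
    also have "\<dots> \<le> hyp_dist 0 \<zeta>\<^sub>0 + (R + inverse (real (Suc n)))"
      using \<zeta>\<^sub>0 c by (simp add: hyp_dist_commute [of \<zeta>\<^sub>0])
    also have "\<dots> \<le> B" by (simp add: B_def inverse_le_1_iff)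
    finally show ?thesis .
  qed
  have "0 \<le> B" using B [of 0] hyp_dist_nonneg [of 0 "c 0"] c(1) [of 0] by simp
  then have k: "0 \<le> k" "k < 1" "hyp_dist 0 (of_real k) = B"
    by (simp_all add: k_def tanh_real_lt_1 hyp_dist_0_tanh)
  have "c n \<in> cball 0 k" for n
    using B [of n] k hyp_dist_0_le_iff [of "c n" "of_real k"] c(1) [of n] by simp
  then obtain l \<phi> where l: "l \<in> cball 0 k" "strict_mono \<phi>" "(c \<circ> \<phi>) \<longlonglongrightarrow> l"
    using compact_cball [of "0 :: complex" k] unfolding compact_def by metis
  have lD: "l \<in> \<D>" using l k by simp
  have "hyp_dist l \<zeta> \<le> R" if \<zeta>: "\<zeta> \<in> E" for \<zeta>
  proof (rule LIMSEQ_le)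
    show "(\<lambda>n. hyp_dist ((c \<circ> \<phi>) n) \<zeta>) \<longlonglongrightarrow> hyp_dist l \<zeta>"
      using l(3) lD subsetD [OF E(2) \<zeta>] by (intro tendsto_hyp_dist tendsto_const)
    have "((\<lambda>n. R + inverse (real (Suc n))) \<circ> \<phi>) \<longlonglongrightarrow> R + 0"
      using l(2) by (intro LIMSEQ_subseq_LIMSEQ tendsto_add tendsto_const LIMSEQ_inverse_real_of_nat)
    then show "(\<lambda>n. R + inverse (real (Suc (\<phi> n)))) \<longlonglongrightarrow> R"
      by (simp add: o_def)
    show "\<exists>N. \<forall>n\<ge>N. hyp_dist ((c \<circ> \<phi>) n) \<zeta> \<le> R + inverse (real (Suc (\<phi> n)))"
      using c(2) [OF \<zeta>] by auto
  qed
  with lD show thesis using that R_def by blast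
qed

section \<open>Farthest points from the circumcentre\<close>

text \<open>\<open>far\<close> says that no centre beats \<open>0\<close>. If a direction
  \<open>a\<close> separated \<open>0\<close> from the farthest points, the points that
  \<open>far\<close> provides for the centres \<open>\<delta> n *\<^sub>R a\<close> would cluster at
  a farthest point \<open>l\<close> with \<open>a \<bullet> l > 0\<close>, while comparing distances
  forces \<open>a \<bullet> l \<le> 0\<close>.\<close>

lemma center_in_convex_hull_farthest:
  assumes E: "compact E" "E \<subseteq> cball 0 r" and r: "0 \<le> r" "r < 1"
    and far: "\<And>c. c \<in> \<D> \<Longrightarrow> \<exists>\<zeta>\<in>E. hyp_dist 0 (of_real r) \<le> hyp_dist c \<zeta>"
  shows "0 \<in> convex hull (E \<inter> sphere 0 r)"
proof (rule ccontr)
  assume "0 \<notin> convex hull (E \<inter> sphere 0 r)"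
  moreover have "closed (convex hull (E \<inter> sphere 0 r))"
    using E by (intro compact_imp_closed compact_convex_hull compact_Int_closed) auto
  ultimately obtain a b where ab: "a \<noteq> 0" "0 < b"
    "\<And>x. x \<in> convex hull (E \<inter> sphere 0 r) \<Longrightarrow> b < a \<bullet> x"
    using separating_hyperplane_closed_0 [OF convex_convex_hull] by metis
  \<comment> \<open>Dividing by \<open>1 + norm a\<close> keeps
    \<open>\<delta> n *\<^sub>R a\<close> in the disc from \<open>n = 0\<close> on.\<close>
  define \<delta> where "\<delta> n = inverse (real (Suc n)) / (1 + norm a)" for n
  have \<delta>: "0 < \<delta> n" for n by (simp add: \<delta>_def add_pos_nonneg)
  have \<delta>0: "\<delta> \<longlonglongrightarrow> 0"
    unfolding \<delta>_def by (rule tendsto_divide_zero [OF LIMSEQ_inverse_real_of_nat])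
  have disc: "\<delta> n *\<^sub>R a \<in> \<D>" for n
  proof -
    have "norm (\<delta> n *\<^sub>R a) = inverse (real (Suc n)) * (norm a / (1 + norm a))"
      using \<delta> [of n] by (simp add: \<delta>_def)
    also have "\<dots> < 1 * 1"
      by (intro mult_le_less_imp_less) (auto simp: inverse_le_1_iff add_pos_nonneg divide_simps)
    finally show ?thesis by simp
  qed
  obtain \<zeta> where \<zeta>: "\<And>n. \<zeta> n \<in> E" "\<And>n. hyp_dist 0 (of_real r) \<le> hyp_dist (\<delta> n *\<^sub>R a) (\<zeta> n)"
    using far [OF disc] by metis
  obtain l \<phi> where l: "l \<in> E" "strict_mono \<phi>" "(\<zeta> \<circ> \<phi>) \<longlonglongrightarrow> l"
    using E(1) \<zeta>(1) unfolding compact_def by metis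
  have ED: "z \<in> \<D>" if "z \<in> E" for z using that E r by force
  have rD: "of_real r \<in> \<D>" using r by simp
  have \<delta>\<phi>: "(\<delta> \<circ> \<phi>) \<longlonglongrightarrow> 0" by (rule LIMSEQ_subseq_LIMSEQ [OF \<delta>0 l(2)])
  have "(\<lambda>n. (\<delta> \<circ> \<phi>) n *\<^sub>R a) \<longlonglongrightarrow> 0 *\<^sub>R a" by (intro tendsto_scaleR \<delta>\<phi> tendsto_const)
  then have "(\<lambda>n. hyp_dist ((\<delta> \<circ> \<phi>) n *\<^sub>R a) ((\<zeta> \<circ> \<phi>) n)) \<longlonglongrightarrow> hyp_dist 0 l"
    by (intro tendsto_hyp_dist l(3) ED [OF l(1)]) simp_all
  then have "hyp_dist 0 (of_real r) \<le> hyp_dist 0 l"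
    by (rule LIMSEQ_le_const) (use \<zeta> in auto)
  then have "r \<le> cmod l" using hyp_dist_0_le_iff [OF rD ED [OF l(1)]] r by simp
  with E l have "l \<in> E \<inter> sphere 0 r" by force
  then have "b < a \<bullet> l" using ab hull_inc by metis
  moreover have "a \<bullet> l \<le> 0"
  proof (rule LIMSEQ_le)
    show "(\<lambda>n. a \<bullet> (\<zeta> \<circ> \<phi>) n) \<longlonglongrightarrow> a \<bullet> l" by (intro tendsto_inner tendsto_const l(3))
    show "(\<lambda>n. (\<delta> \<circ> \<phi>) n * (norm a)\<^sup>2) \<longlonglongrightarrow> 0" by (rule tendsto_mult_left_zero [OF \<delta>\<phi>])
    have "a \<bullet> \<zeta> n \<le> \<delta> n * (norm a)\<^sup>2" for n
    proof -
      have z: "\<zeta> n \<in> \<D>" "cmod (\<zeta> n) \<le> r" using \<zeta> ED E by force+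
      then have "hyp_dist 0 (\<zeta> n) \<le> hyp_dist (\<delta> n *\<^sub>R a) (\<zeta> n)"
        using \<zeta>(2) [of n] hyp_dist_0_le_iff [OF z(1) rD] r by simp
      then have "2 * (\<delta> n * (a \<bullet> \<zeta> n)) \<le> (norm (\<delta> n *\<^sub>R a))\<^sup>2 * (1 + (cmod (\<zeta> n))\<^sup>2)"
        using hyp_dist_0_le_iff_inner [OF disc z(1)] by simp
      also have "\<dots> \<le> (norm (\<delta> n *\<^sub>R a))\<^sup>2 * 2"
        using one_minus_norm_sq_pos [OF z(1)] by (intro mult_left_mono) simp_all
      \<comment> \<open>The left side is linear in \<open>\<delta> n\<close>, the right side
        quadratic; cancelling one factor leaves a bound that tends to 0.\<close>
      finally have "\<delta> n * (a \<bullet> \<zeta> n) \<le> \<delta> n * (\<delta> n * (norm a)\<^sup>2)"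
        by (simp add: power_mult_distrib power2_eq_square algebra_simps)
      then show ?thesis using \<delta> [of n] by simp
    qed
    then show "\<exists>N. \<forall>n\<ge>N. a \<bullet> (\<zeta> \<circ> \<phi>) n \<le> (\<delta> \<circ> \<phi>) n * (norm a)\<^sup>2" by simp
  qed
  ultimately show False using ab by simp
qed

text \<open>By Caratheodory some point \<open>x\<close> carries weight at least \<open>1 / 3\<close> in a representation of \<open>0\<close>;
  pairing the representation with \<open>x\<close> shows that some other point is at angle at least
  \<open>2 * pi / 3\<close> from \<open>x\<close>.\<close>

lemma exists_wide_angle:
  fixes T :: "complex set"
  assumes T: "T \<subseteq> sphere 0 r" and 0: "0 \<in> convex hull T"
  shows "\<exists>z\<in>T. \<exists>w\<in>T. z \<bullet> w \<le> - (r\<^sup>2 / 2)"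
proof (rule ccontr)
  assume "\<not> ?thesis"
  then have neg: "0 < z \<bullet> w + r\<^sup>2 / 2" if "z \<in> T" "w \<in> T" for z w using that by force
  \<comment> \<open>The plane has real dimension 2, so three points suffice.\<close>
  obtain S u where S: "finite S" "S \<subseteq> T" "card S \<le> 3" "\<And>x. x \<in> S \<Longrightarrow> 0 \<le> u x" "sum u S = 1"
    "(\<Sum>v\<in>S. u v *\<^sub>R v) = 0"
    using 0 unfolding convex_hull_caratheodory by auto
  have "\<exists>x\<in>S. 1 / 3 \<le> u x"
  proof (rule ccontr)
    assume "\<not> ?thesis"
    then have less: "u x < 1 / 3" if "x \<in> S" for x using that by force
    have "S \<noteq> {}" using S(5) by auto
    then have "sum u S < of_nat (card S) * (1 / 3)"
      using less S(1) by (intro sum_bounded_above_strict) (auto simp: card_gt_0_iff)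
    also have "\<dots> \<le> 1" using S(3) by simp
    finally show False using S(5) by simp
  qed
  then obtain x where x: "x \<in> S" "1 / 3 \<le> u x" by blast
  have xx: "x \<bullet> x = r\<^sup>2" using x S T by (force simp: power2_norm_eq_inner [symmetric])
  \<comment> \<open>The negated claim at the pair \<open>x\<close>, \<open>x\<close> rules out
    \<open>r = 0\<close>.\<close>
  have r: "0 < r\<^sup>2" using neg [of x x] x S xx by auto
  have "(\<Sum>y\<in>S. u y * (x \<bullet> y)) = x \<bullet> (\<Sum>v\<in>S. u v *\<^sub>R v)" by (simp add: inner_sum_right)
  \<comment> \<open>Adding \<open>r\<^sup>2 / 2\<close> makes every term nonnegative under the
    negated claim. The total is \<open>r\<^sup>2 / 2\<close>, and the term of \<open>x\<close>
    alone, \<open>3 / 2 * r\<^sup>2 * u x\<close>, is at least that.\<close>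
  then have "(\<Sum>y\<in>S. u y * (x \<bullet> y + r\<^sup>2 / 2)) = r\<^sup>2 / 2"
    using S(5,6) by (simp only: distrib_left sum.distrib sum_distrib_right [symmetric]) simp
  then have rest: "(\<Sum>y\<in>S - {x}. u y * (x \<bullet> y + r\<^sup>2 / 2)) = r\<^sup>2 / 2 * (1 - 3 * u x)"
    using S(1) x(1) xx by (simp add: sum_diff1 algebra_simps)
  have nn: "0 \<le> u y * (x \<bullet> y + r\<^sup>2 / 2)" if "y \<in> S - {x}" for y
    using that neg [of x y] x S by (intro mult_nonneg_nonneg) (auto intro: less_imp_le)
  show False
  \<comment> \<open>With all weight on \<open>x\<close> the remaining sum would be
    \<open>- r\<^sup>2\<close>; otherwise another point has positive weight and makes that sum
    positive.\<close>
  proof (cases "u x = 1")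
    case True
    moreover have "0 \<le> (\<Sum>y\<in>S - {x}. u y * (x \<bullet> y + r\<^sup>2 / 2))" by (rule sum_nonneg [OF nn])
    ultimately show False using rest r by simp
  next
    case False
    have "sum u (S - {x}) \<noteq> 0" using False S x by (simp add: sum_diff1)
    then obtain y where y: "y \<in> S - {x}" "u y \<noteq> 0" by (meson sum.neutral)
    then have "0 < u y * (x \<bullet> y + r\<^sup>2 / 2)"
      using S(4) [of y] S(2) neg [of x y] x by (intro mult_pos_pos) auto
    then have "0 < (\<Sum>y\<in>S - {x}. u y * (x \<bullet> y + r\<^sup>2 / 2))"
      using S(1) y by (intro sum_pos2 [of _ y] nn) auto
    moreover have "r\<^sup>2 / 2 * (1 - 3 * u x) \<le> 0"
      using x by (intro mult_nonneg_nonpos) auto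
    ultimately show False using rest by simp
  qed
qed

section \<open>Diameter, the two inequalities, and convex hulls\<close>

lemma hyp_diam_le:
  assumes "E \<noteq> {}" "\<And>\<zeta> \<eta>. \<zeta> \<in> E \<Longrightarrow> \<eta> \<in> E \<Longrightarrow> hyp_dist \<zeta> \<eta> \<le> D"
  shows "hyp_diam E \<le> D"
  unfolding hyp_diam_def by (rule cSUP_least) (use assms in auto)

lemma hyp_dist_le_hyp_diam:
  assumes "compact E" "E \<subseteq> \<D>" "\<zeta> \<in> E" "\<eta> \<in> E"
  shows "hyp_dist \<zeta> \<eta> \<le> hyp_diam E"
proof -
  have "continuous_on (E \<times> E) (\<lambda>p. hyp_dist (fst p) (snd p))"
    by (intro continuous_on_hyp_dist continuous_intros) (use assms in auto)
  then have "bdd_above ((\<lambda>p. hyp_dist (fst p) (snd p)) ` (E \<times> E))"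
    using assms by (intro bounded_imp_bdd_above compact_imp_bounded compact_continuous_image compact_Times)
  from cSUP_upper [OF _ this, of "(\<zeta>, \<eta>)"] show ?thesis
    using assms by (simp add: hyp_diam_def case_prod_unfold)
qed

text \<open>Any centre \<open>c\<close> has a farthest point \<open>\<zeta>\<close> in
  \<open>E\<close>, and the triangle inequality through \<open>c\<close> bounds the diameter by
  twice its distance.\<close>

lemma half_hyp_diam_le_hyp_rad:
  assumes E: "compact E" "E \<subseteq> \<D>" "E \<noteq> {}"
  shows "hyp_diam E / 2 \<le> hyp_rad E"
proof (rule hyp_rad_ge [OF E(1,2)], rule ccontr)
  fix c assume c: "c \<in> \<D>" "\<not> (\<exists>\<zeta>\<in>E. hyp_diam E / 2 \<le> hyp_dist c \<zeta>)"
  have "continuous_on E (hyp_dist c)"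
    by (intro continuous_on_hyp_dist continuous_intros) (use E c in auto)
  then obtain \<zeta> where \<zeta>: "\<zeta> \<in> E" "\<And>\<eta>. \<eta> \<in> E \<Longrightarrow> hyp_dist c \<eta> \<le> hyp_dist c \<zeta>"
    using continuous_attains_sup E by metis
  have "hyp_diam E \<le> 2 * hyp_dist c \<zeta>"
  proof (rule hyp_diam_le [OF E(3)])
    fix x y assume "x \<in> E" "y \<in> E"
    then show "hyp_dist x y \<le> 2 * hyp_dist c \<zeta>"
      using hyp_dist_triangle [of x y c] \<zeta>(2) [of x] \<zeta>(2) [of y] c(1) E by fastforce
  qed
  then show False using c \<zeta> by auto
qed

text \<open>With the circumcentre moved to \<open>0\<close>, two farthest points at a wide angle are
  at Euclidean distance at least \<open>sqrt 3 * r\<close>. Now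
  \<open>sinh R = 2 * r / (1 - r\<^sup>2)\<close>, while half their hyperbolic distance has
  \<open>sinh\<close> equal to \<open>|z - w| / (1 - r\<^sup>2)\<close>; this produces the factor
  \<open>2 / sqrt 3\<close>.\<close>

lemma hyp_rad_le_jung_fun:
  assumes E: "compact E" "E \<subseteq> \<D>" "E \<noteq> {}"
  shows "hyp_rad E \<le> jung_fun (hyp_diam E)"
proof -
  define R where "R = hyp_rad E"
  obtain c where c: "c \<in> \<D>" "\<And>\<zeta>. \<zeta> \<in> E \<Longrightarrow> hyp_dist c \<zeta> \<le> R"
    using hyp_center_exists [OF E] R_def by blast
  have R: "0 \<le> R" using c E hyp_dist_nonneg by (metis ex_in_conv order_trans subsetD)
  define r where "r = tanh (R / 2)"
  have r: "0 \<le> r" "r < 1" "hyp_dist 0 (of_real r) = R" "of_real r \<in> \<D>"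
    using R by (simp_all add: r_def tanh_real_lt_1 hyp_dist_0_tanh)
  define M where "M = Moebius_function 0 c"
  have MD: "M z \<in> \<D>" if "z \<in> \<D>" for z using Moebius_in_disc that c by (simp add: M_def)
  have "0 \<in> convex hull (M ` E \<inter> sphere 0 r)"
  proof (rule center_in_convex_hull_farthest)
    have "continuous_on \<D> M"
      unfolding M_def using c Moebius_function_holomorphic holomorphic_on_imp_continuous_on by simp
    then show "compact (M ` E)"
      using E continuous_on_subset by (blast intro: compact_continuous_image)
    show "M ` E \<subseteq> cball 0 r"
    proof clarify
      fix \<zeta> assume \<zeta>: "\<zeta> \<in> E"
      then have "hyp_dist 0 (M \<zeta>) \<le> hyp_dist 0 (of_real r)"
        using c E r by (auto simp: M_def hyp_dist_Moebius_center)
      then show "M \<zeta> \<in> cball 0 r"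
        using hyp_dist_0_le_iff [OF MD r(4)] \<zeta> E r by auto
    qed
    fix x assume x: "x \<in> \<D>"
    \<comment> \<open>\<open>y\<close> is the preimage of \<open>x\<close> under \<open>M\<close>:
      some point of \<open>E\<close> is at distance at least \<open>R\<close> from it, and
      \<open>M\<close> preserves this.\<close>
    define y where "y = Moebius_function 0 (- c) x"
    have y: "y \<in> \<D>" "M y = x"
      using x c Moebius_in_disc [of x "- c"] Moebius_function_compose [of c "- c" x]
      by (simp_all add: y_def M_def)
    then obtain \<zeta> where \<zeta>: "\<zeta> \<in> E" "R \<le> hyp_dist y \<zeta>"
      using hyp_rad_le_farthest [OF E] R_def by blast
    then have "hyp_dist 0 (of_real r) \<le> hyp_dist x (M \<zeta>)"
      using hyp_dist_Moebius [OF y(1) _ c(1), of \<zeta>] y E r by (auto simp: M_def)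
    then show "\<exists>\<zeta>\<in>M ` E. hyp_dist 0 (of_real r) \<le> hyp_dist x \<zeta>" using \<zeta> by blast
  qed (use r in auto)
  then obtain z w where zw: "z \<in> M ` E \<inter> sphere 0 r" "w \<in> M ` E \<inter> sphere 0 r" "z \<bullet> w \<le> - (r\<^sup>2 / 2)"
    using exists_wide_angle [of "M ` E \<inter> sphere 0 r" r] by blast
  then obtain \<zeta> \<eta> where \<zeta>\<eta>: "\<zeta> \<in> E" "\<eta> \<in> E" "z = M \<zeta>" "w = M \<eta>" by blast
  have norms: "cmod z = r" "cmod w = r" using zw by auto
  have zwD: "z \<in> \<D>" "w \<in> \<D>" using \<zeta>\<eta> MD E by auto
  have r2: "0 < 1 - r\<^sup>2" using one_minus_norm_sq_pos [OF r(4)] by simp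
  have "(cmod (z - w))\<^sup>2 = (cmod z)\<^sup>2 + (cmod w)\<^sup>2 - 2 * (z \<bullet> w)"
    unfolding power2_norm_eq_inner by (simp add: inner_diff inner_commute)
  then have "(sqrt 3 * r)\<^sup>2 \<le> (cmod (z - w))\<^sup>2" using zw(3) norms by (simp add: power_mult_distrib)
  then have side: "sqrt 3 * r \<le> cmod (z - w)" by (rule power2_le_imp_le) simp
  have "sinh R = 2 / sqrt 3 * (sqrt 3 * r / (1 - r\<^sup>2))"
    using sinh_hyp_dist_0 [OF r(4)] r by simp
  also have "\<dots> \<le> 2 / sqrt 3 * (cmod (z - w) / (1 - r\<^sup>2))"
    using side r2 by (intro mult_left_mono divide_right_mono) auto
  also have "cmod (z - w) / (1 - r\<^sup>2) = sinh (hyp_dist z w / 2)"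
    using sinh_half_hyp_dist [OF zwD] norms r2 by simp
  also have "hyp_dist z w = hyp_dist \<zeta> \<eta>"
    unfolding \<zeta>\<eta>(3,4) M_def using \<zeta>\<eta>(1,2) E c by (intro hyp_dist_Moebius) auto
  also have "2 / sqrt 3 * sinh (hyp_dist \<zeta> \<eta> / 2) \<le> 2 / sqrt 3 * sinh (hyp_diam E / 2)"
    using hyp_dist_le_hyp_diam [OF E(1,2) \<zeta>\<eta>(1,2)] by (intro mult_left_mono) auto
  also have "\<dots> = sinh (jung_fun (hyp_diam E))" by (simp add: jung_fun_def)
  finally show ?thesis unfolding R_def sinh_real_le_iff .
qed


text \<open>Convexity of balls is used twice: balls about points of \<open>S\<close> contain the
  hull, so by symmetry a ball about any point of the hull contains \<open>S\<close>, hence the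
  hull.\<close>

lemma hyp_dist_le_on_convex_hull:
  assumes S: "S \<subseteq> \<D>" "\<And>x y. x \<in> S \<Longrightarrow> y \<in> S \<Longrightarrow> hyp_dist x y \<le> t" and t: "0 \<le> t"
    and z: "z \<in> convex hull S" and w: "w \<in> convex hull S"
  shows "hyp_dist z w \<le> t"
proof -
  have HD: "convex hull S \<subseteq> \<D>" using S by (intro hull_minimal) auto
  have 1: "convex hull S \<subseteq> {y \<in> \<D>. hyp_dist x y \<le> t}" if "x \<in> S" for x
    using S that t by (intro hull_minimal convex_hyp_ball) auto
  have "convex hull S \<subseteq> {y \<in> \<D>. hyp_dist z y \<le> t}"
  proof (intro hull_minimal convex_hyp_ball t)
    show "S \<subseteq> {y \<in> \<D>. hyp_dist z y \<le> t}"
    proof clarify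
      fix x assume x: "x \<in> S"
      then have "x \<in> \<D>" "z \<in> \<D>" "hyp_dist x z \<le> t" using 1 [OF x] S(1) z by blast+
      then show "x \<in> \<D> \<and> hyp_dist z x \<le> t" by (metis hyp_dist_commute)
    qed
    show "z \<in> \<D>" using z HD by blast
  qed
  then show ?thesis using w by blast
qed

section \<open>Dilatations of harmonic mappings\<close>

lemma closure_dilatation_image:
  assumes f: "op_harmonic_mapping f" and sup: "sup_norm_disc (dilatation f) < 1"
  shows "compact (closure (dilatation f ` \<D>))" "closure (dilatation f ` \<D>) \<subseteq> \<D>"
    "closure (dilatation f ` \<D>) \<noteq> {}"
proof -
  let ?k = "sup_norm_disc (dilatation f)"
  obtain h g where hg: "harmonic_decomp f h g"
    "\<And>z. z \<in> \<D> \<Longrightarrow> (cmod (deriv h z))\<^sup>2 - (cmod (deriv g z))\<^sup>2 > 0"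
    using f unfolding op_harmonic_mapping_def by blast
  \<comment> \<open>The positive Jacobian bounds the dilatation; a real-valued supremum controls the
    values only of a bounded family.\<close>
  have "cmod (dilatation f z) \<le> 1" if "z \<in> \<D>" for z
  proof -
    have "(cmod (deriv g z))\<^sup>2 \<le> (cmod (deriv h z))\<^sup>2" using hg(2) [OF that] by linarith
    then have "cmod (deriv g z) \<le> cmod (deriv h z)" by (rule power2_le_imp_le) simp
    then show ?thesis by (simp add: dilatation_eq [OF hg(1) that] norm_divide divide_le_eq_1)
  qed
  then have "bdd_above ((\<lambda>z. cmod (dilatation f z)) ` \<D>)" by (intro bdd_aboveI2)
  then have "cmod (dilatation f z) \<le> ?k" if "z \<in> \<D>" for z
    unfolding sup_norm_disc_def using that by (intro cSUP_upper)
  then have "dilatation f ` \<D> \<subseteq> cball 0 ?k" by auto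
  then have sub: "closure (dilatation f ` \<D>) \<subseteq> cball 0 ?k" by (simp add: closure_minimal)
  then show "closure (dilatation f ` \<D>) \<subseteq> \<D>" using sup by (auto simp: subset_iff)
  from sub have "bounded (closure (dilatation f ` \<D>))" using bounded_cball bounded_subset by blast
  then show "compact (closure (dilatation f ` \<D>))" by (simp add: compact_eq_bounded_closed)
qed simp

text \<open>With \<open>h z = z\<close> and \<open>g' = \<omega>\<close>, the perturbation \<open>cnj \<circ> g\<close> of the identity is a strict
  contraction, so \<open>h + cnj \<circ> g\<close> is injective.\<close>

lemma univalent_harmonic_qc_with_dilatation:
  assumes holo: "\<omega> holomorphic_on \<D>" and bound: "\<And>z. z \<in> \<D> \<Longrightarrow> cmod (\<omega> z) \<le> k" and k: "k < 1"
  obtains f where "univalent_harmonic_qc f" "dilatation f ` \<D> = \<omega> ` \<D>"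
proof -
  obtain g where g': "\<And>z. z \<in> \<D> \<Longrightarrow> (g has_field_derivative \<omega> z) (at z within \<D>)"
    using holomorphic_convex_primitive' [OF convex_ball open_ball holo] by blast
  then have g: "(g has_field_derivative \<omega> z) (at z)" if "z \<in> \<D>" for z
    using that by (metis at_within_open open_ball)
  define f where "f z = z + cnj (g z)" for z
  have "g holomorphic_on \<D>" using g' holomorphic_on_def field_differentiable_def by metis
  then have hd: "harmonic_decomp f (\<lambda>z. z) g"
    by (simp add: harmonic_decomp_def f_def)
  have dil: "dilatation f z = \<omega> z" if "z \<in> \<D>" for z
    using dilatation_eq [OF hd that] DERIV_imp_deriv [OF g [OF that]] by simp
  have "0 < (cmod (deriv (\<lambda>z. z) z))\<^sup>2 - (cmod (deriv g z))\<^sup>2" if z: "z \<in> \<D>" for z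
    using DERIV_imp_deriv [OF g [OF z]] one_minus_norm_sq_pos [of "\<omega> z"] bound [OF z] k by simp
  then have "op_harmonic_mapping f" unfolding op_harmonic_mapping_def using hd by blast
  moreover have "inj_on f \<D>"
  proof (rule inj_onI, rule ccontr)
    fix z w assume zw: "z \<in> \<D>" "w \<in> \<D>" "f z = f w" "z \<noteq> w"
    then have "z - w = cnj (g w - g z)" by (simp add: f_def algebra_simps)
    then have "cmod (z - w) = cmod (g w - g z)" by (metis complex_mod_cnj)
    also have "\<dots> \<le> k * cmod (w - z)"
      using zw by (intro field_differentiable_bound [OF convex_ball g' bound])
    also have "\<dots> < 1 * cmod (w - z)" using zw k by (intro mult_strict_right_mono) auto
    finally show False by (simp add: norm_minus_commute)
  qed
  moreover have "sup_norm_disc (dilatation f) \<le> k"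
    unfolding sup_norm_disc_def using bound dil by (intro cSUP_least) auto
  ultimately have "univalent_harmonic_qc f" using k by (simp add: univalent_harmonic_qc_def)
  moreover have "dilatation f ` \<D> = \<omega> ` \<D>" by (intro image_cong dil refl)
  ultimately show thesis by (rule that)
qed

section \<open>Extremal mappings\<close>

text \<open>The closed image of \<open>\<omega> z = of_real a * z\<close> is the hyperbolic ball of
  radius \<open>t / 2\<close> about \<open>0\<close>; antipodal points realise the diameter, and the
  general lower bound then fixes the radius.\<close>

lemma exists_hyp_rad_eq_half_diam:
  assumes t: "0 \<le> t"
  shows "\<exists>f. univalent_harmonic_qc f \<and> d_aff f = t \<and> r_aff f = t / 2"
proof -
  define a where "a = tanh (t / 2 / 2)"
  have a: "0 \<le> a" "a < 1" "hyp_dist 0 (of_real a) = t / 2" "of_real a \<in> \<D>"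
    using t hyp_dist_0_tanh [of "t / 2"] by (simp_all add: a_def tanh_real_lt_1)
  define \<omega> :: "complex \<Rightarrow> complex" where "\<omega> z = of_real a * z" for z
  have "cmod (\<omega> z) \<le> a" if "z \<in> \<D>" for z
    using that a mult_left_le [of "cmod z" a] by (simp add: \<omega>_def norm_mult)
  moreover have "\<omega> holomorphic_on \<D>" unfolding \<omega>_def by (intro holomorphic_intros)
  ultimately obtain f where f: "univalent_harmonic_qc f" "dilatation f ` \<D> = \<omega> ` \<D>"
    using univalent_harmonic_qc_with_dilatation a(2) by metis
  define E where "E = closure (\<omega> ` \<D>)"
  have E: "compact E" "E \<subseteq> \<D>" "E \<noteq> {}"
    using closure_dilatation_image [of f] f by (simp_all add: univalent_harmonic_qc_def E_def)
  have sub: "E \<subseteq> cball 0 a"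
    unfolding E_def using \<open>\<And>z. z \<in> \<D> \<Longrightarrow> cmod (\<omega> z) \<le> a\<close> by (intro closure_minimal) auto
  \<comment> \<open>\<open>of_real a\<close> and its negative are values of \<open>\<omega>\<close>
    at boundary points, so they belong to \<open>E\<close> by continuity.\<close>
  have "\<omega> ` closure \<D> \<subseteq> E"
    unfolding E_def \<omega>_def by (intro image_closure_subset continuous_intros closure_subset) auto
  then have "\<omega> 1 \<in> E" "\<omega> (- 1) \<in> E" by auto
  then have mem: "of_real a \<in> E" "- of_real a \<in> E" by (simp_all add: \<omega>_def)
  have le: "hyp_dist 0 \<zeta> \<le> t / 2" if "\<zeta> \<in> E" for \<zeta>
    using hyp_dist_0_le_iff [of \<zeta> "of_real a"] that E sub a by auto
  have "hyp_diam E \<le> t"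
  proof (rule hyp_diam_le [OF E(3)])
    fix \<zeta> \<eta> assume "\<zeta> \<in> E" "\<eta> \<in> E"
    then show "hyp_dist \<zeta> \<eta> \<le> t"
      using hyp_dist_triangle_0 [of \<zeta> \<eta>] le [of \<zeta>] le [of \<eta>] E(2) by force
  qed
  moreover have "t \<le> hyp_diam E"
  proof -
    have "sinh (hyp_dist (of_real a) (- of_real a) / 2) = 2 * a / (1 - a\<^sup>2)"
      using sinh_half_hyp_dist [of "of_real a" "- of_real a"] a one_minus_norm_sq_pos [OF a(4)]
      by (simp flip: of_real_add)
    also have "\<dots> = sinh (t / 2)" using sinh_hyp_dist_0 [OF a(4)] a by simp
    finally show ?thesis using hyp_dist_le_hyp_diam [OF E(1,2) mem] by simp
  qed
  moreover have "hyp_rad E \<le> t / 2" using E le by (intro hyp_rad_le [of _ 0]) auto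
  ultimately have "hyp_diam E = t" "hyp_rad E = t / 2"
    using half_hyp_diam_le_hyp_rad [OF E] by linarith+
  then show ?thesis using f by (auto simp: d_aff_def r_aff_def E_def)
qed

text \<open>The equality case of the wide-angle argument: three vertices at distance
  \<open>R = jung_fun t\<close> from \<open>0\<close>, pairwise at angle \<open>2 * pi / 3\<close>.
  Positive \<open>t\<close> gives the triangle an interior, which the Riemann mapping theorem
  needs.\<close>

lemma exists_hyp_rad_eq_jung_fun:
  assumes t: "0 < t"
  shows "\<exists>f. univalent_harmonic_qc f \<and> d_aff f = t \<and> r_aff f = jung_fun t"
proof -
  define R where "R = jung_fun t"
  have R: "0 < R" using t by (simp add: R_def jung_fun_def)
  define a where "a = tanh (R / 2)"
  have a: "0 < a" "a < 1" "hyp_dist 0 (of_real a) = R" "of_real a \<in> \<D>"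
    using R hyp_dist_0_tanh [of R] by (simp_all add: a_def tanh_real_lt_1)
  have a2: "0 < 1 - a\<^sup>2" using one_minus_norm_sq_pos [OF a(4)] by simp
  \<comment> \<open>\<open>b\<close> is \<open>a * sin (2 * pi / 3)\<close>: the vertices are
    \<open>a\<close> times the cube roots of unity.\<close>
  define b where "b = sqrt 3 / 2 * a"
  have b: "0 < b" "b * b = 3 / 4 * (a * a)" "b * (b * 4) = a * (a * 3)"
    using a by (simp_all add: b_def)
  define v\<^sub>0 v\<^sub>1 v\<^sub>2 where "v\<^sub>0 = Complex a 0" "v\<^sub>1 = Complex (- a / 2) b" "v\<^sub>2 = Complex (- a / 2) (- b)"
  note v_defs = this
  define V where "V = {v\<^sub>0, v\<^sub>1, v\<^sub>2}"
  have normV: "cmod v = a" if "v \<in> V" for v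
  proof -
    have "(cmod v)\<^sup>2 = a\<^sup>2"
      using that unfolding cmod_power2 by (auto simp: V_def v_defs power2_eq_square b)
    then show ?thesis using a by simp
  qed
  have VD: "v \<in> \<D>" if "v \<in> V" for v using normV [OF that] a by simp
  have side: "cmod (v - w) = sqrt 3 * a" if "v \<in> V" "w \<in> V" "v \<noteq> w" for v w
  proof -
    have "(cmod (v - w))\<^sup>2 = (sqrt 3 * a)\<^sup>2"
      using that unfolding cmod_power2 power_mult_distrib
      by (auto simp: V_def v_defs power2_eq_square algebra_simps b)
    then show ?thesis using a by (subst (asm) power2_eq_iff_nonneg) auto
  qed
  have sinhR: "sinh R = 2 * a / (1 - a\<^sup>2)" using sinh_hyp_dist_0 [OF a(4)] a by simp
  have dist: "hyp_dist v w = t" if "v \<in> V" "w \<in> V" "v \<noteq> w" for v w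
  proof -
    have "sinh (hyp_dist v w / 2) = sqrt 3 * a / (1 - a\<^sup>2)"
      using sinh_half_hyp_dist [OF VD VD] side normV that a2 by simp
    \<comment> \<open>Inverting \<open>jung_fun\<close>: \<open>R\<close> was chosen so that the
      sides have hyperbolic length \<open>t\<close>.\<close>
    also have "\<dots> = sqrt 3 / 2 * sinh R" by (simp add: sinhR)
    also have "\<dots> = sinh (t / 2)" by (simp add: R_def jung_fun_def)
    finally show ?thesis by simp
  qed
  define S where "S = interior (convex hull V)"
  have noncol: "\<not> collinear {v\<^sub>0, v\<^sub>1, v\<^sub>2}"
  proof
    assume "collinear {v\<^sub>0, v\<^sub>1, v\<^sub>2}"
    then obtain u where u: "v\<^sub>1 = u *\<^sub>R v\<^sub>0 + (1 - u) *\<^sub>R v\<^sub>2"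
      using a by (auto simp: collinear_3_expand v_defs)
    then have "3 * a * u = 0" "b * (2 - u) = 0"
      by (auto simp: v_defs complex_eq_iff algebra_simps)
    then show False using a b by simp
  qed
  have "v\<^sub>0 /\<^sub>R 3 + v\<^sub>1 /\<^sub>R 3 + v\<^sub>2 /\<^sub>R 3 \<in> S"
    unfolding S_def V_def using interior_convex_hull_3_minimal [OF noncol]
    by (force intro!: exI [of _ "1/3"] simp: inverse_eq_divide)
  then have S: "S \<noteq> {}" by blast
  define E where "E = closure S"
  \<comment> \<open>A convex set with nonempty interior has the same closure as its interior, so
    \<open>E\<close> regains the vertices.\<close>
  have EV: "E = convex hull V"
  proof -
    have "E = closure (convex hull V)"
      using S convex_closure_interior [OF convex_convex_hull] by (simp add: E_def S_def)
    also have "\<dots> = convex hull V"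
      by (intro closure_closed compact_imp_closed compact_convex_hull) (simp add: V_def)
    finally show ?thesis .
  qed
  have sub: "E \<subseteq> cball 0 a" unfolding EV using normV by (intro hull_minimal) auto
  have "open S" "simply_connected S"
    unfolding S_def by (simp_all add: convex_imp_simply_connected convex_interior)
  moreover have "S \<noteq> UNIV"
    using sub bounded_cball not_bounded_UNIV closure_subset unfolding E_def by (metis bounded_subset)
  \<comment> \<open>The inverse Riemann map \<open>\<omega>\<close> serves as dilatation: its image
    is exactly the open triangle.\<close>
  ultimately have "\<exists>\<psi> \<omega>. \<omega> holomorphic_on \<D> \<and> (\<forall>z\<in>S. \<psi> z \<in> \<D> \<and> \<omega> (\<psi> z) = z) \<and> (\<forall>z\<in>\<D>. \<omega> z \<in> S)"
    using Riemann_mapping_theorem [of S] S by metis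
  then obtain \<psi> \<omega> where \<omega>: "\<omega> holomorphic_on \<D>" "\<And>z. z \<in> S \<Longrightarrow> \<psi> z \<in> \<D> \<and> \<omega> (\<psi> z) = z"
    "\<And>z. z \<in> \<D> \<Longrightarrow> \<omega> z \<in> S"
    by metis
  have im: "\<omega> ` \<D> = S" using \<omega>(2,3) by force
  have "cmod (\<omega> z) \<le> a" if "z \<in> \<D>" for z
    using \<omega>(3) [OF that] sub closure_subset [of S] by (auto simp: E_def)
  then obtain f where f: "univalent_harmonic_qc f" "dilatation f ` \<D> = S"
    using univalent_harmonic_qc_with_dilatation [OF \<omega>(1) _ a(2)] im by metis
  have E: "compact E" "E \<subseteq> \<D>" "E \<noteq> {}"
    using closure_dilatation_image [of f] f by (simp_all add: univalent_harmonic_qc_def E_def)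
  have V_E: "V \<subseteq> E" by (simp add: EV hull_subset)
  have dist_le: "hyp_dist v w \<le> t" if "v \<in> V" "w \<in> V" for v w
    using dist [OF that] t by (cases "v = w") (auto simp: hyp_dist_def)
  have "hyp_dist \<zeta> \<eta> \<le> t" if "\<zeta> \<in> E" "\<eta> \<in> E" for \<zeta> \<eta>
    using that VD t unfolding EV
    by (intro hyp_dist_le_on_convex_hull [OF _ dist_le]) auto
  then have "hyp_diam E \<le> t" by (rule hyp_diam_le [OF E(3)])
  moreover have "t \<le> hyp_diam E"
  proof -
    have "v\<^sub>0 \<in> V" "v\<^sub>1 \<in> V" "v\<^sub>0 \<noteq> v\<^sub>1" using a b by (auto simp: V_def v_defs)
    then show ?thesis using hyp_dist_le_hyp_diam [OF E(1,2), of v\<^sub>0 v\<^sub>1] V_E dist [of v\<^sub>0 v\<^sub>1] by auto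
  qed
  ultimately have diam: "hyp_diam E = t" by simp
  have "hyp_rad E \<le> R"
  proof (rule hyp_rad_le [OF E, of 0])
    fix \<zeta> assume "\<zeta> \<in> E"
    then show "hyp_dist 0 \<zeta> \<le> R"
      using hyp_dist_0_le_iff [of \<zeta> "of_real a"] E sub a by auto
  qed simp
  moreover have "R \<le> hyp_rad E"
  proof (rule hyp_rad_ge [OF E(1,2)])
    fix c assume c: "c \<in> \<D>"
    \<comment> \<open>The vertices sum to \<open>0\<close>, so some vertex has nonpositive inner
      product with \<open>c\<close> and is no closer to \<open>c\<close> than to
      \<open>0\<close>.\<close>
    have "c \<bullet> v\<^sub>0 + c \<bullet> v\<^sub>1 + c \<bullet> v\<^sub>2 = 0"
      by (simp add: v_defs inner_complex_def algebra_simps)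
    then have "\<exists>v\<in>V. c \<bullet> v \<le> 0" by (auto simp: V_def)
    then obtain v where v: "v \<in> V" "c \<bullet> v \<le> 0" by blast
    have "2 * (c \<bullet> v) \<le> 0" using v by simp
    also have "0 \<le> (cmod c)\<^sup>2 * (1 + (cmod v)\<^sup>2)" by simp
    finally have "hyp_dist 0 v \<le> hyp_dist c v"
      using hyp_dist_0_le_iff_inner [OF c VD [OF v(1)]] by simp
    moreover have "R \<le> hyp_dist 0 v"
      using hyp_dist_0_le_iff [OF a(4) VD [OF v(1)]] a normV [OF v(1)] by simp
    ultimately show "\<exists>\<zeta>\<in>E. R \<le> hyp_dist c \<zeta>" using v V_E by force
  qed
  ultimately have "hyp_rad E = jung_fun t" by (simp add: R_def)
  then show ?thesis using f diam by (auto simp: d_aff_def r_aff_def E_def)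
qed

theorem theorem1p4:
  "(\<forall>f. op_harmonic_mapping f \<and> sup_norm_disc (dilatation f) < 1 \<longrightarrow>
      d_aff f / 2 \<le> r_aff f \<and> r_aff f \<le> jung_fun (d_aff f)) \<and>
   (\<forall>t\<ge>0. \<exists>f. univalent_harmonic_qc f \<and> d_aff f = t \<and> r_aff f = t / 2) \<and>
   (\<forall>t\<ge>0. \<exists>f. univalent_harmonic_qc f \<and> d_aff f = t \<and> r_aff f = jung_fun t)"
proof (intro conjI allI impI)
  fix f assume "op_harmonic_mapping f \<and> sup_norm_disc (dilatation f) < 1"
  then have E: "compact (closure (dilatation f ` \<D>))" "closure (dilatation f ` \<D>) \<subseteq> \<D>"
    "closure (dilatation f ` \<D>) \<noteq> {}"
    using closure_dilatation_image by blast+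
  show "d_aff f / 2 \<le> r_aff f"
    unfolding d_aff_def r_aff_def by (rule half_hyp_diam_le_hyp_rad [OF E])
  show "r_aff f \<le> jung_fun (d_aff f)"
    unfolding d_aff_def r_aff_def by (rule hyp_rad_le_jung_fun [OF E])
next
  fix t :: real assume "0 \<le> t"
  then show "\<exists>f. univalent_harmonic_qc f \<and> d_aff f = t \<and> r_aff f = t / 2"
    by (rule exists_hyp_rad_eq_half_diam)
next
  fix t :: real assume t: "0 \<le> t"
  show "\<exists>f. univalent_harmonic_qc f \<and> d_aff f = t \<and> r_aff f = jung_fun t"
  \<comment> \<open>At \<open>t = 0\<close> both bounds are 0, and the disc example, then a single
    point, serves here too.\<close>
  proof (cases "t = 0")
    case True
    then show ?thesis using exists_hyp_rad_eq_half_diam [of 0] by (simp add: jung_fun_def)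
  next
    case False
    then show ?thesis using exists_hyp_rad_eq_jung_fun t by simp
  qed
qed

end
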